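(* Let $n\ge 1$ be an integer and let $x_1,\dots,x_n,a,t$ be complex numbers with $|x_1|,\dots,|x_n|<1$, $|t|<1$ and $|at|<1$. Then $$\prod_{\alpha_1,\alpha_2,\dots,\alpha_n\ge 0}\left(\frac{1-x_1^{\alpha_1}x_2^{\alpha_2}\cdots x_n^{\alpha_n}\,a\,t}{1-x_1^{\alpha_1}x_2^{\alpha_2}\cdots x_n^{\alpha_n}\,t}\right)^{\frac{1}{\alpha_1!\,\alpha_2!\cdots\alpha_n!}}=\sum_{k=0}^{\infty}B_k\,t^k,$$ where $B_0=1$ and, for every $k\ge 1$, $$B_k=\frac{1}{k!}\det(a_{ij})_{1\le i,j\le k},\qquad a_{ij}=\begin{cases}\left(1-a^{\,i-j+1}\right)\exp\left(x_1^{\,i-j+1}+x_2^{\,i-j+1}+\cdots+x_n^{\,i-j+1}\right), & i\ge j,\\ -i, & i=j-1,\\ 0, & \text{otherwise.}\end{cases}$$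
   Context: The product runs over all $n$-tuples $(\alpha_1,\dots,\alpha_n)$ of non-negative integers, including the tuple with all entries zero; $x^0=1$ for every $x$. For $|u|,|v|<1$ and real $r$, the power $\left(\frac{1-u}{1-v}\right)^r$ means $\exp\big(r(\log(1-u)-\log(1-v))\big)$ with the principal branch of $\log$. *)

theory Defs
  imports "HOL-Analysis.Analysis" "Jordan_Normal_Form.Determinant"
begin

text \<open>
  Unordered infinite product over an arbitrary index set: the counterpart of \<^const>\<open>has_sum\<close>, with the
  convention of \<^const>\<open>has_prod\<close> that, after finitely many factors are split off, the finite partial
  products converge to a nonzero limit.
\<close>

definition has_unordered_prod ::
  "('i \<Rightarrow> 'a::{t2_space, comm_semiring_1}) \<Rightarrow> 'i set \<Rightarrow> 'a \<Rightarrow> bool"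
  where "has_unordered_prod f A p \<longleftrightarrow>
    (\<exists>Z q. finite Z \<and> Z \<subseteq> A \<and> (prod f \<longlongrightarrow> q) (finite_subsets_at_top (A - Z)) \<and> q \<noteq> 0 \<and>
      p = prod f Z * q)"

definition ratio_power :: "complex \<Rightarrow> complex \<Rightarrow> real \<Rightarrow> complex"
  where "ratio_power u v r = exp (of_real r * (Ln (1 - u) - Ln (1 - v)))"

text \<open>The tuples \<open>(\<alpha>\<^sub>1, \<dots>, \<alpha>\<^sub>n)\<close> are the functions on \<open>{1..n}\<close>, extended by \<^const>\<open>undefined\<close>.\<close>

definition exponent_tuples :: "nat \<Rightarrow> (nat \<Rightarrow> nat) set"
  where "exponent_tuples n = {1..n} \<rightarrow>\<^sub>E UNIV"

definition prod_factor ::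
  "nat \<Rightarrow> (nat \<Rightarrow> complex) \<Rightarrow> complex \<Rightarrow> complex \<Rightarrow> (nat \<Rightarrow> nat) \<Rightarrow> complex"
  where "prod_factor n x a t \<alpha> =
    ratio_power ((\<Prod>l\<in>{1..n}. x l ^ \<alpha> l) * a * t) ((\<Prod>l\<in>{1..n}. x l ^ \<alpha> l) * t)
      (1 / (\<Prod>l\<in>{1..n}. fact (\<alpha> l)))"

definition B_entry :: "nat \<Rightarrow> (nat \<Rightarrow> complex) \<Rightarrow> complex \<Rightarrow> nat \<Rightarrow> nat \<Rightarrow> complex"
  where "B_entry n x a i j =
    (if i \<ge> j then (1 - a ^ (i - j + 1)) * exp (\<Sum>l\<in>{1..n}. x l ^ (i - j + 1))
     else if i + 1 = j then - of_nat i
     else 0)"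

text \<open>Matrices are indexed from 0, the entries \<^const>\<open>B_entry\<close> from 1.\<close>

definition B :: "nat \<Rightarrow> (nat \<Rightarrow> complex) \<Rightarrow> complex \<Rightarrow> nat \<Rightarrow> complex"
  where "B n x a k =
    (if k = 0 then 1
     else Determinant.det (Matrix.mat k k (\<lambda>(i, j). B_entry n x a (i + 1) (j + 1))) / fact k)"

end

theory Submission
  imports Defs "HOL-Complex_Analysis.Complex_Analysis"
begin

text \<open>
  Expanding \<open>Ln (1 - u)\<close> in each factor and interchanging the two absolutely convergent sums, the
  logarithm of the product is \<open>\<Sum>m\<ge>1. c m / m * t ^ m\<close> with
  \<open>c m = (1 - a ^ m) * exp (x\<^sub>1 ^ m + \<dots> + x\<^sub>n ^ m)\<close>, because the weights \<open>1 / (\<alpha>\<^sub>1! \<dots> \<alpha>\<^sub>n!)\<close> turn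
  the sum over all tuples into a product of exponential series. This power series converges on the
  disc \<open>\<bar>t\<bar> < 1 / max 1 \<bar>a\<bar>\<close>, hence so does the Taylor series of its exponential. Logarithmic
  differentiation gives the recurrence \<open>k * b k = (\<Sum>j<k. c (k - j) * b j)\<close> for the Taylor
  coefficients, which is a triangular linear system; Cramer's rule yields the determinants.
\<close>

section \<open>Determinant of a Hessenberg matrix built from a recurrence\<close>

text \<open>
  The recurrence says that the matrix maps \<open>(b 0, \<dots>, b (k - 1))\<close> to \<open>(0, \<dots>, 0, k * b k)\<close>. Since
  \<open>b 0 = 1\<close>, replacing the first column by this image (multiplication by the unitriangular \<open>P\<close>)
  preserves the determinant, and the only remaining minor is triangular.
\<close>

lemma det_hessenberg:
  fixes b c :: "nat \<Rightarrow> 'a :: {comm_ring_1, semiring_char_0}"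
  assumes b0: "b 0 = 1"
    and rec: "\<And>k. of_nat (Suc k) * b (Suc k) = (\<Sum>j\<le>k. c (Suc (k - j)) * b j)"
  shows "Determinant.det (Matrix.mat k k (\<lambda>(i, j). if j \<le> i then c (Suc (i - j))
    else if j = Suc i then - of_nat (Suc i) else 0)) = fact k * b k"
proof (cases k)
  case 0
  then show ?thesis using b0 by (simp add: det_dim_zero)
next
  case (Suc m)
  define A where "A = Matrix.mat k k (\<lambda>(i, j). if j \<le> i then c (Suc (i - j))
    else if j = Suc i then - of_nat (Suc i) else 0)"
  define P where "P = Matrix.mat k k (\<lambda>(i, j). if j = 0 then b i else if i = j then 1 else 0)"
  have A: "A \<in> carrier_mat k k" and P: "P \<in> carrier_mat k k"
    by (auto simp: A_def P_def)
  have AP: "A * P \<in> carrier_mat k k"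
    using A P by simp
  have "diag_mat P = replicate k 1"
    by (rule nth_equalityI) (auto simp: diag_mat_def P_def b0)
  moreover have "Determinant.det P = prod_list (diag_mat P)"
    by (rule det_lower_triangular[OF _ P]) (auto simp: P_def)
  ultimately have detP: "Determinant.det P = 1"
    by simp
  have AP_index: "(A * P) $$ (i, j) = (\<Sum>l<k. A $$ (i, l) * P $$ (l, j))"
    if "i < k" "j < k" for i j
    using that A P by (simp add: times_mat_def scalar_prod_def atLeast0LessThan)
  \<comment> \<open>Row \<open>i\<close> reaches one place beyond the diagonal. There
    \<open>- (i + 1) * b (i + 1)\<close> cancels the rest of the row by the recurrence; in the last
    row, \<open>i = m\<close>, that column lies outside the matrix, so \<open>k * b k\<close>
    survives.\<close>
  have col0: "(A * P) $$ (i, 0) = (if i = m then of_nat k * b k else 0)" if i: "i < k" for i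
  proof -
    have "(A * P) $$ (i, 0) = (\<Sum>l<k. A $$ (i, l) * b l)"
      using i by (subst AP_index) (auto simp: P_def)
    also have "\<dots> = (\<Sum>l\<in>{..<k} \<inter> {..Suc i}. A $$ (i, l) * b l)"
      using i by (intro sum.mono_neutral_right) (auto simp: A_def)
    also have "\<dots> = (if i = m then of_nat k * b k else 0)"
    proof (cases "i = m")
      case True
      then have "{..<k} \<inter> {..Suc i} = {..m}"
        using Suc by auto
      then show ?thesis
        using True Suc rec[of m] by (auto simp: A_def intro!: sum.cong)
    next
      case False
      then have "{..<k} \<inter> {..Suc i} = insert (Suc i) {..i}"
        using i Suc by auto
      moreover have "(\<Sum>l\<le>i. A $$ (i, l) * b l) = of_nat (Suc i) * b (Suc i)"
        unfolding rec using i by (intro sum.cong) (auto simp: A_def)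
      moreover have "A $$ (i, Suc i) = - of_nat (Suc i)"
        using i False Suc by (auto simp: A_def)
      ultimately show ?thesis
        using False by (simp del: of_nat_Suc)
    qed
    finally show ?thesis .
  qed
  have colS: "(A * P) $$ (i, Suc j) = A $$ (i, Suc j)" if "i < k" "j < m" for i j
  proof -
    have j: "Suc j < k"
      using that Suc by simp
    have "(A * P) $$ (i, Suc j) = (\<Sum>l<k. if l = Suc j then A $$ (i, l) else 0)"
      unfolding AP_index[OF that(1) j] using j by (intro sum.cong) (auto simp: P_def)
    also have "\<dots> = A $$ (i, Suc j)"
      using j by simp
    finally show ?thesis .
  qed
  \<comment> \<open>Deleting the last row and the first column moves the superdiagonal of
    \<open>A\<close> onto the diagonal, with only zeros above it.\<close>
  define M where "M = mat_delete (A * P) m 0"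
  have M: "M \<in> carrier_mat m m"
    using mat_delete_carrier[OF AP] Suc by (simp add: M_def)
  have M_index: "M $$ (i, j) = A $$ (i, Suc j)" if "i < m" "j < m" for i j
    using that A P Suc colS[of i j] by (simp add: M_def mat_delete_def)
  have "diag_mat M = map (\<lambda>i. - of_nat (Suc i)) [0..<m]"
    using M M_index Suc by (auto simp: diag_mat_def A_def)
  moreover have "Determinant.det M = prod_list (diag_mat M)"
    using Suc by (intro det_lower_triangular[OF _ M]) (auto simp: M_index A_def)
  moreover have "prod_list (map (\<lambda>i. - of_nat (Suc i)) [0..<m]) = (-1) ^ m * (fact m :: 'a)"
    by (induction m) (simp_all add: algebra_simps)
  ultimately have detM: "Determinant.det M = (-1) ^ m * fact m"
    by simp
  have "Determinant.det A = Determinant.det (A * P)"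
    using det_mult[OF A P] detP by simp
  also have "\<dots> = (\<Sum>i<k. (A * P) $$ (i, 0) * cofactor (A * P) i 0)"
    using Suc by (intro laplace_expansion_column[OF AP]) simp
  also have "\<dots> = (\<Sum>i<k. if i = m then of_nat k * b k * cofactor (A * P) i 0 else 0)"
    by (intro sum.cong) (auto simp: col0)
  also have "\<dots> = of_nat k * b k * cofactor (A * P) m 0"
    using Suc by simp
  also have "\<dots> = of_nat k * b k * ((-1) ^ m * ((-1) ^ m * fact m))"
    by (simp add: cofactor_def M_def[symmetric] detM)
  also have "(-1) ^ m * ((-1) ^ m * fact m) = (fact m :: 'a)"
    by (simp add: mult.assoc[symmetric] power_add[symmetric])
  finally show ?thesis
    using Suc by (simp add: A_def algebra_simps)
qed

section \<open>Sums over tuples as products of sums\<close>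

text \<open>A finite set of functions lies in the box of its coordinate projections
  \<open>C x\<close>. Over that finite box the sum of products factors, and each factor is at most
  the full infinite sum.\<close>

lemma abs_summable_on_prod_PiE:
  fixes f :: "'a \<Rightarrow> 'b \<Rightarrow> 'c :: {banach, real_normed_field}"
  assumes A: "finite A" and f: "\<And>x. x \<in> A \<Longrightarrow> (\<lambda>y. norm (f x y)) summable_on D x"
  shows "(\<lambda>g. norm (\<Prod>x\<in>A. f x (g x))) summable_on PiE A D"
proof (rule nonneg_bdd_above_summable_on)
  show "bdd_above (sum (\<lambda>g. norm (\<Prod>x\<in>A. f x (g x))) ` {F. F \<subseteq> PiE A D \<and> finite F})"
  proof (intro bdd_aboveI2)
    fix F assume "F \<in> {F. F \<subseteq> PiE A D \<and> finite F}"
    then have F: "F \<subseteq> PiE A D" "finite F"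
      by auto
    define C where "C x = (\<lambda>g. g x) ` F" for x
    have C: "finite (C x)" for x
      using F by (simp add: C_def)
    have CB: "C x \<subseteq> D x" if "x \<in> A" for x
      using F that by (auto simp: C_def)
    have fin: "finite (PiE A C)"
      using A C by (simp add: finite_PiE)
    have "(\<Sum>g\<in>F. norm (\<Prod>x\<in>A. f x (g x))) \<le> (\<Sum>g\<in>PiE A C. norm (\<Prod>x\<in>A. f x (g x)))"
      using F fin by (intro sum_mono2) (auto simp: C_def PiE_def)
    also have "\<dots> = (\<Sum>g\<in>PiE A C. \<Prod>x\<in>A. norm (f x (g x)))"
      by (simp add: prod_norm)
    also have "\<dots> = (\<Prod>x\<in>A. \<Sum>y\<in>C x. norm (f x y))"
      using infsum_prod_PiE_abs[OF A, of "\<lambda>x y. norm (f x y)" C] C fin by simp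
    also have "\<dots> \<le> (\<Prod>x\<in>A. \<Sum>\<^sub>\<infinity>y\<in>D x. norm (f x y))"
      using C CB f by (intro prod_mono) (auto intro!: finite_sum_le_infsum sum_nonneg)
    finally show "(\<Sum>g\<in>F. norm (\<Prod>x\<in>A. f x (g x))) \<le> (\<Prod>x\<in>A. \<Sum>\<^sub>\<infinity>y\<in>D x. norm (f x y))" .
  qed
qed simp

lemma has_sum_prod_PiE_abs:
  fixes f :: "'a \<Rightarrow> 'b \<Rightarrow> 'c :: {banach, real_normed_field}"
  assumes "finite A" and "\<And>x. x \<in> A \<Longrightarrow> (\<lambda>y. norm (f x y)) summable_on D x"
    and "\<And>x. x \<in> A \<Longrightarrow> (f x has_sum s x) (D x)"
  shows "((\<lambda>g. \<Prod>x\<in>A. f x (g x)) has_sum (\<Prod>x\<in>A. s x)) (PiE A D)"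
proof -
  have "(\<lambda>g. \<Prod>x\<in>A. f x (g x)) summable_on PiE A D"
    using abs_summable_on_prod_PiE[OF assms(1,2)] by (rule abs_summable_summable)
  moreover have "(\<Prod>x\<in>A. infsum (f x) (D x)) = (\<Prod>x\<in>A. s x)"
    using assms(3) by (intro prod.cong) (auto simp: infsumI)
  ultimately show ?thesis
    using infsum_prod_PiE_abs[of A f D] assms has_sum_infsum by metis
qed

lemma exp_has_sum:
  fixes z :: "'a :: {banach, real_normed_field}"
  shows "((\<lambda>k. z ^ k / fact k) has_sum exp z) UNIV" "(\<lambda>k. norm (z ^ k / fact k)) summable_on UNIV"
proof -
  have eq: "z ^ k /\<^sub>R fact k = z ^ k / fact k" for k
    by (simp add: scaleR_conv_of_real field_simps)
  have s: "summable (\<lambda>k. norm (z ^ k / fact k))"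
    using summable_norm_exp[of z] by (simp only: eq)
  show "((\<lambda>k. z ^ k / fact k) has_sum exp z) UNIV"
    using exp_converges[of z] s unfolding eq by (intro norm_summable_imp_has_sum)
  show "(\<lambda>k. norm (z ^ k / fact k)) summable_on UNIV"
    using s by (subst summable_on_UNIV_nonneg_real_iff) auto
qed

definition tuple_weight :: "nat \<Rightarrow> (nat \<Rightarrow> nat) \<Rightarrow> real"
  where "tuple_weight n \<alpha> = 1 / (\<Prod>l\<in>{1..n}. fact (\<alpha> l))"

lemma tuple_weight_nonneg: "tuple_weight n \<alpha> \<ge> 0"
  by (simp add: tuple_weight_def prod_nonneg)

text \<open>Multiply out \<open>n\<close> exponential series. The type is left general: real
  \<open>y = 1\<close> gives the finite total weight, complex \<open>y l = x l ^ m\<close> gives the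
  coefficients of the logarithm.\<close>

lemma tuple_exp_has_sum:
  fixes y :: "nat \<Rightarrow> 'a :: {banach, real_normed_field}"
  shows "((\<lambda>\<alpha>. of_real (tuple_weight n \<alpha>) * (\<Prod>l\<in>{1..n}. y l ^ \<alpha> l)) has_sum
    exp (\<Sum>l\<in>{1..n}. y l)) (exponent_tuples n)"
proof -
  have "((\<lambda>\<alpha>. \<Prod>l\<in>{1..n}. y l ^ \<alpha> l / fact (\<alpha> l)) has_sum (\<Prod>l\<in>{1..n}. exp (y l)))
      (exponent_tuples n)"
    unfolding exponent_tuples_def by (intro has_sum_prod_PiE_abs exp_has_sum) auto
  then show ?thesis
    by (simp add: tuple_weight_def prod_dividef exp_sum)
qed

lemma norm_divide_of_nat_le:
  fixes w :: "'a :: real_normed_field"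
  shows "norm (w / of_nat m) \<le> norm w"
proof (cases "m = 0")
  case False
  then have "norm w * 1 \<le> norm w * real m"
    by (intro mult_left_mono) auto
  with False show ?thesis
    by (simp add: norm_divide divide_le_eq)
qed simp

section \<open>The logarithm of the product as a power series\<close>

text \<open>The geometric series dominates, so the Taylor series of the logarithm is also an
  unordered sum. The index \<open>m = 0\<close> contributes nothing, since division by zero yields
  0.\<close>

lemma Ln_one_minus_has_sum:
  assumes "norm u < 1"
  shows "((\<lambda>m. - (u ^ m / of_nat m)) has_sum Ln (1 - u)) UNIV"
proof (rule norm_summable_imp_has_sum)
  show "(\<lambda>m. - (u ^ m / of_nat m)) sums Ln (1 - u)"
    using Ln_series'[of "- u"] assms by simp
  show "summable (\<lambda>m. norm (- (u ^ m / of_nat m)))"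
  proof (rule summable_comparison_test')
    show "summable (\<lambda>m. norm u ^ m)"
      using assms by (simp add: summable_geometric)
    show "norm (norm (- (u ^ m / of_nat m))) \<le> norm u ^ m" if "m \<ge> 0" for m
      using norm_divide_of_nat_le[of "u ^ m" m] by (simp add: norm_power)
  qed
qed

text \<open>This is \<open>c m\<close> in the overview; with \<open>m = i - j + 1\<close> it is also
  the matrix entry on and below the diagonal.\<close>

definition log_coeff :: "nat \<Rightarrow> (nat \<Rightarrow> complex) \<Rightarrow> complex \<Rightarrow> nat \<Rightarrow> complex"
  where "log_coeff n x a m = (1 - a ^ m) * exp (\<Sum>l\<in>{1..n}. x l ^ m)"

lemma prod_factor_eq:
  "prod_factor n x a t \<alpha> = exp (of_real (tuple_weight n \<alpha>) *
    (Ln (1 - (\<Prod>l\<in>{1..n}. x l ^ \<alpha> l) * a * t) - Ln (1 - (\<Prod>l\<in>{1..n}. x l ^ \<alpha> l) * t)))"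
  by (simp add: prod_factor_def ratio_power_def tuple_weight_def)

text \<open>Fubini for one absolutely summable double family \<open>h\<close> over pairs of a tuple
  and an exponent \<open>m\<close>: summing over \<open>m\<close> first gives the logarithms of the
  factors, summing over tuples first gives the power series. Both orders share the value
  \<open>S\<close>.\<close>

lemma log_has_sum:
  assumes x: "\<And>l. l \<in> {1..n} \<Longrightarrow> norm (x l) < 1" and t: "norm t < 1" and at: "norm (a * t) < 1"
  shows "\<exists>S. (\<lambda>m. log_coeff n x a m / of_nat m * t ^ m) sums S \<and>
    ((\<lambda>\<alpha>. of_real (tuple_weight n \<alpha>) *
      (Ln (1 - (\<Prod>l\<in>{1..n}. x l ^ \<alpha> l) * a * t) - Ln (1 - (\<Prod>l\<in>{1..n}. x l ^ \<alpha> l) * t)))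
      has_sum S) (exponent_tuples n)"
proof -
  define p where "p \<alpha> = (\<Prod>l\<in>{1..n}. x l ^ \<alpha> l)" for \<alpha> :: "nat \<Rightarrow> nat"
  define h where "h = (\<lambda>(\<alpha>, m). of_real (tuple_weight n \<alpha>) *
    (p \<alpha> ^ m * ((1 - a ^ m) * t ^ m / of_nat m)))"
  define A where "A = exponent_tuples n"
  \<comment> \<open>Equality occurs at the zero tuple, so decay in \<open>m\<close> has to come from
    \<open>t\<close> and \<open>a * t\<close>, and decay in the tuple from the weights.\<close>
  have p: "norm (p \<alpha>) \<le> 1" for \<alpha>
    unfolding p_def prod_norm[symmetric]
    by (intro prod_le_1 conjI norm_ge_zero) (simp add: norm_power power_le_one less_imp_le x)
  have geom: "((\<lambda>m. norm t ^ m + norm (a * t) ^ m) has_sum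
      (1 / (1 - norm t) + 1 / (1 - norm (a * t)))) UNIV"
    using t at geometric_sums[of "norm t"] geometric_sums[of "norm (a * t)"]
    by (intro has_sum_add norm_summable_imp_has_sum) (auto simp del: norm_mult)
  have "(\<lambda>(\<alpha>, m). tuple_weight n \<alpha> * (norm t ^ m + norm (a * t) ^ m)) summable_on (A \<times> UNIV)"
  proof (rule summable_on_SigmaI)
    show "((\<lambda>m. case (\<alpha>, m) of (\<alpha>, m) \<Rightarrow> tuple_weight n \<alpha> * (norm t ^ m + norm (a * t) ^ m))
        has_sum (tuple_weight n \<alpha> * (1 / (1 - norm t) + 1 / (1 - norm (a * t))))) UNIV" for \<alpha>
      using has_sum_cmult_right[OF geom] by simp
    have "tuple_weight n summable_on A"
      using tuple_exp_has_sum[of n "\<lambda>_. 1 :: real"] by (auto simp: A_def summable_on_def)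
    then show "(\<lambda>\<alpha>. tuple_weight n \<alpha> * (1 / (1 - norm t) + 1 / (1 - norm (a * t)))) summable_on A"
      by (rule summable_on_cmult_left)
  qed (auto simp: tuple_weight_nonneg)
  then have "(\<lambda>y. norm (h y)) summable_on (A \<times> UNIV)"
  proof (rule summable_on_comparison_test)
    fix y :: "(nat \<Rightarrow> nat) \<times> nat"
    obtain \<alpha> m where y: "y = (\<alpha>, m)" by fastforce
    have "norm ((1 - a ^ m) * t ^ m / of_nat m) \<le> norm ((1 - a ^ m) * t ^ m)"
      by (rule norm_divide_of_nat_le)
    also have "\<dots> = norm (t ^ m - (a * t) ^ m)"
      by (simp add: algebra_simps)
    also have "\<dots> \<le> norm t ^ m + norm (a * t) ^ m"
      using norm_triangle_ineq4[of "t ^ m" "(a * t) ^ m"] by (simp only: norm_power)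
    finally have "norm (p \<alpha>) ^ m * norm ((1 - a ^ m) * t ^ m / of_nat m)
        \<le> 1 * (norm t ^ m + norm (a * t) ^ m)"
      by (intro mult_mono power_le_one p) auto
    then have "tuple_weight n \<alpha> * (norm (p \<alpha>) ^ m * norm ((1 - a ^ m) * t ^ m / of_nat m))
        \<le> tuple_weight n \<alpha> * (norm t ^ m + norm (a * t) ^ m)"
      by (intro mult_left_mono tuple_weight_nonneg) simp
    then show "norm (h y) \<le> (case y of (\<alpha>, m) \<Rightarrow> tuple_weight n \<alpha> * (norm t ^ m + norm (a * t) ^ m))"
      using tuple_weight_nonneg[of n \<alpha>]
      by (simp only: y h_def norm_mult norm_power norm_of_real prod.case abs_of_nonneg)
  qed simp
  then obtain S where S: "(h has_sum S) (A \<times> UNIV)"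
    using abs_summable_summable summable_on_def by blast
  have row: "((\<lambda>m. h (\<alpha>, m)) has_sum
      (of_real (tuple_weight n \<alpha>) * (Ln (1 - p \<alpha> * a * t) - Ln (1 - p \<alpha> * t)))) UNIV" for \<alpha>
  proof -
    have "norm (p \<alpha>) * norm (a * t) < 1" "norm (p \<alpha>) * norm t < 1"
      using mult_right_mono[OF p[of \<alpha>]] t at by (metis mult_1 norm_ge_zero order.strict_trans1)+
    then have "norm (p \<alpha> * a * t) < 1" "norm (p \<alpha> * t) < 1"
      by (simp_all add: norm_mult mult.assoc)
    then have "((\<lambda>m. of_real (tuple_weight n \<alpha>) *
        (- ((p \<alpha> * a * t) ^ m / of_nat m) + (- 1) * - ((p \<alpha> * t) ^ m / of_nat m))) has_sum
        (of_real (tuple_weight n \<alpha>) *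
          (Ln (1 - p \<alpha> * a * t) + (- 1) * Ln (1 - p \<alpha> * t)))) UNIV"
      by (intro has_sum_cmult_right has_sum_add Ln_one_minus_has_sum)
    then show ?thesis
      by (simp add: h_def power_mult_distrib diff_divide_distrib algebra_simps)
  qed
  \<comment> \<open>The power \<open>p \<alpha> ^ m\<close> is the same monomial evaluated at the
    \<open>x l ^ m\<close>, so the weighted sum over tuples is an exponential.\<close>
  have col: "((\<lambda>\<alpha>. h (\<alpha>, m)) has_sum (log_coeff n x a m / of_nat m * t ^ m)) A" for m
  proof -
    have "((\<lambda>\<alpha>. of_real (tuple_weight n \<alpha>) * (\<Prod>l\<in>{1..n}. (x l ^ m) ^ \<alpha> l) *
        ((1 - a ^ m) * t ^ m / of_nat m)) has_sum
        (exp (\<Sum>l\<in>{1..n}. x l ^ m) * ((1 - a ^ m) * t ^ m / of_nat m))) A"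
      unfolding A_def by (intro has_sum_cmult_left tuple_exp_has_sum)
    moreover have "(\<Prod>l\<in>{1..n}. (x l ^ m) ^ \<alpha> l) = p \<alpha> ^ m" for \<alpha>
      by (simp add: p_def prod_power_distrib power_mult[symmetric] mult.commute)
    ultimately show ?thesis
      by (simp add: h_def log_coeff_def mult_ac)
  qed
  have "((\<lambda>m. log_coeff n x a m / of_nat m * t ^ m) has_sum S) UNIV"
    by (rule has_sum_SigmaD[OF S[unfolded has_sum_swap[of h]]]) (simp only: prod.case col)
  moreover have "((\<lambda>\<alpha>. of_real (tuple_weight n \<alpha>) * (Ln (1 - p \<alpha> * a * t) - Ln (1 - p \<alpha> * t)))
      has_sum S) A"
    using S row by (rule has_sum_SigmaD)
  ultimately show ?thesis
    unfolding A_def p_def by (blast intro: has_sum_imp_sums)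
qed

text \<open>Continuity of \<open>exp\<close> carries the limit of finite sums to finite products. As
  \<open>exp S\<close> is nonzero, \<open>Z = {}\<close> serves as witness.\<close>

lemma has_unordered_prod_exp:
  fixes g :: "'i \<Rightarrow> 'a :: {banach, real_normed_field}"
  assumes "(g has_sum S) A"
  shows "has_unordered_prod (\<lambda>i. exp (g i)) A (exp S)"
proof -
  have "((\<lambda>F. exp (sum g F)) \<longlongrightarrow> exp S) (finite_subsets_at_top A)"
    using assms unfolding has_sum_def by (rule tendsto_exp)
  moreover have "\<forall>\<^sub>F F in finite_subsets_at_top A. exp (sum g F) = prod (\<lambda>i. exp (g i)) F"
    by (rule eventually_finite_subsets_at_top_weakI) (simp add: exp_sum)
  ultimately have "(prod (\<lambda>i. exp (g i)) \<longlongrightarrow> exp S) (finite_subsets_at_top A)"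
    by (rule Lim_transform_eventually)
  then show ?thesis
    unfolding has_unordered_prod_def by (intro exI[of _ "{}"] exI[of _ "exp S"]) auto
qed

section \<open>The determinants as Taylor coefficients\<close>

text \<open>For \<open>F = exp G\<close> as formal power series, comparing coefficients in
  \<open>F' = F * G'\<close> gives exactly the recurrence required by \<open>det_hessenberg\<close>;
  differentiating \<open>G\<close> cancels the denominators \<open>m\<close>.\<close>

lemma B_eq_fps_nth:
  "B n x a k = fps_nth (fps_exp 1 oo Abs_fps (\<lambda>m. log_coeff n x a m / of_nat m)) k"
proof -
  define G where "G = Abs_fps (\<lambda>m. log_coeff n x a m / of_nat m)"
  define F where "F = fps_exp 1 oo G"
  have F0: "fps_nth F 0 = 1"
    by (simp add: F_def)
  have G0: "fps_nth G 0 = 0"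
    by (simp add: G_def)
  have deriv: "fps_deriv F = F * fps_deriv G"
    using fps_compose_deriv[OF G0, of "fps_exp 1"] by (simp add: F_def)
  have "of_nat (Suc k) * fps_nth F (Suc k) =
      (\<Sum>j\<le>k. log_coeff n x a (Suc (k - j)) * fps_nth F j)" for k
  proof -
    have "of_nat (Suc k) * fps_nth F (Suc k) = fps_nth (F * fps_deriv G) k"
      by (simp flip: deriv)
    also have "\<dots> = (\<Sum>j\<le>k. fps_nth F j * log_coeff n x a (Suc (k - j)))"
      unfolding fps_mult_nth atLeast0AtMost
      by (intro sum.cong) (auto simp: G_def simp del: of_nat_Suc)
    finally show ?thesis
      by (simp add: mult.commute)
  qed
  note det = det_hessenberg[OF F0 this, of k]
  have "Matrix.mat k k (\<lambda>(i, j). B_entry n x a (i + 1) (j + 1)) =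
      Matrix.mat k k (\<lambda>(i, j). if j \<le> i then log_coeff n x a (Suc (i - j))
        else if j = Suc i then - of_nat (Suc i) else 0)"
    by (rule eq_matI) (auto simp: B_entry_def log_coeff_def)
  with det have "B n x a k = fps_nth F k"
    by (auto simp: B_def F0)
  then show ?thesis
    by (simp add: F_def G_def)
qed

section \<open>Convergence on the disc and conclusion\<close>

theorem theorem4p1:
  fixes n :: nat and x :: "nat \<Rightarrow> complex" and a t :: complex
  assumes "n \<ge> 1"
    and "\<And>l. l \<in> {1..n} \<Longrightarrow> norm (x l) < 1"
    and "norm t < 1"
    and "norm (a * t) < 1"
  shows "summable (\<lambda>k. B n x a k * t ^ k) \<and>
    has_unordered_prod (prod_factor n x a t) (exponent_tuples n) (\<Sum>k. B n x a k * t ^ k)"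
proof -
  define G where "G = Abs_fps (\<lambda>m. log_coeff n x a m / of_nat m)"
  \<comment> \<open>The two bounds \<open>norm z < 1\<close> and \<open>norm (a * z) < 1\<close>
    together describe the disc of radius \<open>R\<close>; the maximum with 1 also covers
    \<open>a = 0\<close>.\<close>
  define R where "R = ereal (1 / max 1 (norm a))"
  have "0 < R"
    by (simp add: R_def)
  have in_R: "norm z < 1 \<and> norm (a * z) < 1 \<longleftrightarrow> norm z < R" for z
  proof -
    have "norm z < R \<longleftrightarrow> norm z * max 1 (norm a) < 1"
      by (simp add: R_def pos_less_divide_eq)
    also have "norm z * max 1 (norm a) = max (norm z) (norm (a * z))"
      by (simp add: max_mult_distrib_left norm_mult mult.commute)
    finally show ?thesis
      by simp
  qed
  have summ: "(\<lambda>m. fps_nth G m * z ^ m) sums eval_fps G z" if "norm z < R" for z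
    using log_has_sum[of n x z a] assms(2) in_R[of z] that
    by (auto simp: G_def eval_fps_def sums_iff)
  have R: "R \<le> fps_conv_radius G"
    unfolding fps_conv_radius_def
  proof (rule conv_radius_geI_ex')
    show "summable (\<lambda>n. fps_nth G n * of_real r ^ n)" if "0 < r" "ereal r < R" for r
      using summ[of "of_real r"] that by (auto simp: sums_iff)
  qed
  \<comment> \<open>The formal composition is the Taylor series of
    \<open>exp \<circ> eval_fps G\<close> at 0. This function is holomorphic on the whole disc of
    radius \<open>R\<close>, so the series converges to it at \<open>t\<close>.\<close>
  have "(exp \<circ> eval_fps G) has_fps_expansion (fps_exp 1 oo G)"
    using \<open>0 < R\<close> R
    by (intro has_fps_expansion_compose has_fps_expansion_exp1 eval_fps_has_fps_expansion)
       (auto simp: G_def)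
  moreover have "(exp \<circ> eval_fps G) holomorphic_on eball 0 R"
    unfolding o_def using R by (intro holomorphic_intros) (auto intro: less_le_trans)
  moreover have "norm t < R"
    using in_R assms by blast
  ultimately have "(\<lambda>k. fps_nth (fps_exp 1 oo G) k * t ^ k) sums (exp \<circ> eval_fps G) t"
    by (rule has_fps_expansion_imp_sums_complex)
  then have sums: "(\<lambda>k. B n x a k * t ^ k) sums exp (eval_fps G t)"
    by (simp add: B_eq_fps_nth G_def)
  obtain S where S: "(\<lambda>m. log_coeff n x a m / of_nat m * t ^ m) sums S"
    and log: "((\<lambda>\<alpha>. of_real (tuple_weight n \<alpha>) *
      (Ln (1 - (\<Prod>l\<in>{1..n}. x l ^ \<alpha> l) * a * t) - Ln (1 - (\<Prod>l\<in>{1..n}. x l ^ \<alpha> l) * t)))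
      has_sum S) (exponent_tuples n)"
    using log_has_sum[of n x t a] assms by blast
  \<comment> \<open>Uniqueness of the sum of the power series links the value of the product to that
    of the Taylor series.\<close>
  have "S = eval_fps G t"
    using S by (simp add: G_def eval_fps_def sums_iff)
  then have "has_unordered_prod (prod_factor n x a t) (exponent_tuples n) (exp (eval_fps G t))"
    using has_unordered_prod_exp[OF log] by (simp only: prod_factor_eq[symmetric])
  with sums show ?thesis
    by (simp add: sums_iff)
qed

end
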